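(* Let $(X,d_X,\leq_{P_1})$ and $(Y,d_Y,\leq_{P_2})$ be two partially ordered complete metric spaces and let $F:X\times Y\rightarrow X$, $G:Y\times X\rightarrow Y$ be two mappings (not assumed continuous) having the mixed monotone property. Assume that $X$ and $Y$ satisfy the following property: (i) if a non-decreasing sequence $\{x_j\}$ in $X$ converges to $x\in X$, then $x_j\leq_{P_1} x$ for all $j$; (ii) if a non-increasing sequence $\{y_j\}$ in $Y$ converges to $y\in Y$, then $y\leq_{P_2} y_j$ for all $j$. Also assume that there exist $a,b,c$ with $a+b+c<1$ satisfying $$d_X(F(x,y),F(u,v))\leq a\, d_X(x,F(x,y))+b\, d_X(u, F(u,v))+c\, d_X(x,u)\quad \text{for all } x,u\in X,\ y,v\in Y \text{ with } x\geq_{P_1}u,\ y\leq_{P_2}v,$$ $$d_Y(G(y,x),G(v,u))\leq a\, d_Y(y,G(y,x))+b\, d_Y(v,G(v,u))+c\, d_Y(y,v)\quad \text{for all } x,u\in X,\ y,v\in Y \text{ with } x\leq_{P_1}u,\ y\geq_{P_2}v.$$ If there exist $x_0\in X$, $y_0\in Y$ satisfying $x_0\leq_{P_1} F(x_0, y_0)$ and $y_0\geq_{P_2} G(y_0, x_0)$, then there exist $x\in X$, $y\in Y$ such that $x=F(x,y)$ and $y=G(y,x)$.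
   Context: A partially ordered complete metric space $(X,d_X,\leq_{P_1})$ is a set $X$ with a metric $d_X$ for which it is complete and a partial order $\leq_{P_1}$ (no compatibility between them is assumed beyond what is stated). The constants $a,b,c$ are real numbers. The maps $F:X\times Y\to X$ and $G:Y\times X\to Y$ have the mixed monotone property if for all $x\in X$, $y\in Y$: for all $x_1,x_2\in X$, $x_1\leq_{P_1} x_2$ implies $F(x_1,y)\leq_{P_1} F(x_2,y)$ and $G(y,x_1)\geq_{P_2}G(y,x_2)$; and for all $y_1,y_2\in Y$, $y_1\leq_{P_2}y_2$ implies $F(x,y_1)\geq_{P_1}F(x,y_2)$ and $G(y_1,x)\leq_{P_2}G(y_2,x)$.
   Formalization: The formal theorem additionally assumes a < 1 and b < 1 (automatic for nonnegative a, b, c); for arbitrary real constants the claim fails, e.g. X = [0,∞), Y a point, F(x,y) = 10x+1, a = 2, b = 0, c = −2. *)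

theory Defs
  imports "HOL-Analysis.Analysis"
begin

text \<open>
  A partially ordered complete metric space is a type of sort \<open>{complete_space, order}\<close>: the two
  classes are independent, so no compatibility between the metric and the order is implied.

  The constants \<open>a\<close>, \<open>b\<close>, \<open>c\<close> of the contraction condition are real and may be negative, but \<open>a < 1\<close> and
  \<open>b < 1\<close> are required.  For nonnegative constants both follow from \<open>a + b + c < 1\<close>; for arbitrary
  real constants they do not, and the claim fails without them: take \<open>F (x, y) = 10 * x + 1\<close> on the
  nonnegative reals, \<open>Y\<close> a single point, \<open>a = 2\<close>, \<open>b = 0\<close>, \<open>c = -2\<close>.
\<close>

definition mixed_monotone ::
  "('a::order \<times> 'b::order \<Rightarrow> 'a) \<Rightarrow> ('b \<times> 'a \<Rightarrow> 'b) \<Rightarrow> bool" where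
  "mixed_monotone F G \<longleftrightarrow>
     (\<forall>x y.
        (\<forall>x1 x2. x1 \<le> x2 \<longrightarrow> F (x1, y) \<le> F (x2, y) \<and> G (y, x1) \<ge> G (y, x2)) \<and>
        (\<forall>y1 y2. y1 \<le> y2 \<longrightarrow> F (x, y1) \<ge> F (x, y2) \<and> G (y1, x) \<le> G (y2, x)))"

end

theory Submission
  imports Defs
begin

text \<open>
  Iterating \<open>(x, y) \<mapsto> (F (x, y), G (y, x))\<close> from the given initial point produces, by mixed
  monotonicity, an increasing sequence in \<open>X\<close> and a decreasing sequence in \<open>Y\<close>.  The contraction
  conditions along consecutive iterates give the ratios \<open>(b + c) / (1 - a)\<close> and \<open>(a + c) / (1 - b)\<close>,
  both below \<open>1\<close>, so both sequences converge.  The order conditions on limits make the limit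
  comparable with every iterate; letting the iterate converge in the contraction condition leaves
  \<open>d x (F (x, y)) \<le> a * d x (F (x, y))\<close> and \<open>d y (G (y, x)) \<le> b * d y (G (y, x))\<close>.
\<close>

lemma dist_le_sum_dist_Suc:
  fixes s :: "nat \<Rightarrow> 'a::metric_space"
  assumes "m \<le> n"
  shows "dist (s m) (s n) \<le> (\<Sum>k=m..<n. dist (s k) (s (Suc k)))"
  using assms
proof (induction n rule: dec_induct)
  case base
  show ?case by simp
next
  case (step n)
  have "dist (s m) (s (Suc n)) \<le> dist (s m) (s n) + dist (s n) (s (Suc n))"
    by (rule dist_triangle)
  with step show ?case by simp
qed

text \<open>By the triangle inequality, distances between late terms are bounded by blocks of a
  convergent series.\<close>

lemma Cauchy_if_summable_dist_Suc:
  fixes s :: "nat \<Rightarrow> 'a::metric_space"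
  assumes "summable (\<lambda>n. dist (s n) (s (Suc n)))"
  shows "Cauchy s"
proof (rule CauchyI')
  fix e :: real
  assume "e > 0"
  then obtain N where N: "\<And>m n. m \<ge> N \<Longrightarrow> norm (\<Sum>k=m..<n. dist (s k) (s (Suc k))) < e"
    using assms unfolding summable_Cauchy by metis
  have "dist (s m) (s n) < e" if "m \<ge> N" "n > m" for m n
    using dist_le_sum_dist_Suc[of m n s] N[OF that(1), of n] that by simp
  then show "\<exists>M. \<forall>m\<ge>M. \<forall>n>m. dist (s m) (s n) < e" by blast
qed

text \<open>As \<open>p < 1\<close>, the \<open>p\<close> term can be absorbed on the left. This
  leaves the ratio \<open>q / (1 - p)\<close>, which is below 1 because \<open>p + q < 1\<close>, so
  the ratio test makes the step lengths summable.\<close>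

lemma convergent_if_dist_Suc_contracts:
  fixes s :: "nat \<Rightarrow> 'a::complete_space" and p q :: real
  assumes p: "p < 1" and pq: "p + q < 1"
    and step: "\<And>n. dist (s (Suc n)) (s (Suc (Suc n)))
      \<le> p * dist (s (Suc n)) (s (Suc (Suc n))) + q * dist (s n) (s (Suc n))"
  shows "convergent s"
proof -
  \<comment> \<open>\<open>q\<close> may be negative, hence the truncation at \<open>0\<close>.\<close>
  define r where "r = max 0 (q / (1 - p))"
  have r: "r < 1" using p pq by (simp add: r_def divide_simps)
  have ratio: "dist (s (Suc n)) (s (Suc (Suc n))) \<le> r * dist (s n) (s (Suc n))" for n
  proof -
    have "dist (s (Suc n)) (s (Suc (Suc n))) \<le> q / (1 - p) * dist (s n) (s (Suc n))"
      using step[of n] p by (simp add: field_simps)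
    also have "\<dots> \<le> r * dist (s n) (s (Suc n))"
      by (intro mult_right_mono) (auto simp: r_def)
    finally show ?thesis .
  qed
  have "summable (\<lambda>n. dist (s n) (s (Suc n)))"
    by (rule summable_ratio_test[OF r, of 0]) (use ratio in simp)
  then show ?thesis
    using Cauchy_if_summable_dist_Suc Cauchy_convergent by blast
qed

text \<open>Meant for \<open>z\<close> the image of the limit point: the \<open>q\<close> and
  \<open>r\<close> terms vanish as \<open>n\<close> grows, and only the \<open>p\<close> term
  survives.\<close>

lemma limit_eq_if_dist_contracts:
  fixes s :: "nat \<Rightarrow> 'a::metric_space" and p q r :: real
  assumes lim: "s \<longlonglongrightarrow> x" and p: "p < 1"
    and le: "\<And>n. dist z (s (Suc n)) \<le> p * dist x z + q * dist (s n) (s (Suc n)) + r * dist x (s n)"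
  shows "x = z"
proof -
  have lim': "(\<lambda>n. s (Suc n)) \<longlonglongrightarrow> x" using lim by (rule LIMSEQ_Suc)
  \<comment> \<open>The zero terms \<open>dist x x\<close> are kept so that the right-hand side has
    the shape produced by \<open>tendsto_intros\<close>.\<close>
  have "dist z x \<le> p * dist x z + q * dist x x + r * dist x x"
  proof (rule tendsto_le[OF sequentially_bot _ _ always_eventually])
    show "(\<lambda>n. dist z (s (Suc n))) \<longlonglongrightarrow> dist z x"
      by (intro tendsto_intros lim')
    show "(\<lambda>n. p * dist x z + q * dist (s n) (s (Suc n)) + r * dist x (s n))
        \<longlonglongrightarrow> p * dist x z + q * dist x x + r * dist x x"
      by (intro tendsto_intros lim lim')
  qed (use le in blast)
  then have "(1 - p) * dist x z \<le> 0" by (simp add: dist_commute algebra_simps)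
  with p show ?thesis by (simp add: mult_le_0_iff)
qed

theorem theorem2p9:
  fixes F :: "'a::{complete_space, order} \<times> 'b::{complete_space, order} \<Rightarrow> 'a"
    and G :: "'b \<times> 'a \<Rightarrow> 'b"
    and a b c :: real
  assumes mixed: "mixed_monotone F G"
    and limX: "\<And>(s :: nat \<Rightarrow> 'a) x. incseq s \<Longrightarrow> s \<longlonglongrightarrow> x \<Longrightarrow> (\<forall>j. s j \<le> x)"
    and limY: "\<And>(t :: nat \<Rightarrow> 'b) y. decseq t \<Longrightarrow> t \<longlonglongrightarrow> y \<Longrightarrow> (\<forall>j. y \<le> t j)"
    and abc: "a + b + c < 1" and a: "a < 1" and b: "b < 1"
    and contrF: "\<And>x u y v. x \<ge> u \<Longrightarrow> y \<le> v \<Longrightarrow>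
      dist (F (x, y)) (F (u, v))
        \<le> a * dist x (F (x, y)) + b * dist u (F (u, v)) + c * dist x u"
    and contrG: "\<And>x u y v. x \<le> u \<Longrightarrow> y \<ge> v \<Longrightarrow>
      dist (G (y, x)) (G (v, u))
        \<le> a * dist y (G (y, x)) + b * dist v (G (v, u)) + c * dist y v"
    and init: "\<exists>x0 y0. x0 \<le> F (x0, y0) \<and> y0 \<ge> G (y0, x0)"
  shows "\<exists>x y. x = F (x, y) \<and> y = G (y, x)"
proof -
  obtain x0 y0 where x0: "x0 \<le> F (x0, y0)" and y0: "G (y0, x0) \<le> y0"
    using init by blast
  \<comment> \<open>Change one argument at a time, through an intermediate value of
    \<open>F\<close>.\<close>
  have F_mono: "F (x1, y1) \<le> F (x2, y2)" if "x1 \<le> x2" "y2 \<le> y1" for x1 x2 y1 y2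
    using mixed that unfolding mixed_monotone_def by (meson order_trans)
  have G_mono: "G (y1, x1) \<le> G (y2, x2)" if "y1 \<le> y2" "x2 \<le> x1" for x1 x2 y1 y2
    using mixed that unfolding mixed_monotone_def by (meson order_trans)
  define w where "w n = ((\<lambda>(x, y). (F (x, y), G (y, x))) ^^ n) (x0, y0)" for n
  define s where "s n = fst (w n)" for n
  define t where "t n = snd (w n)" for n
  have s_Suc: "s (Suc n) = F (s n, t n)" and t_Suc: "t (Suc n) = G (t n, s n)" for n
    by (simp_all add: s_def t_def w_def split: prod.split)
  have mono: "s n \<le> s (Suc n) \<and> t (Suc n) \<le> t n" for n
  proof (induction n)
    case 0
    have "s 0 = x0" "t 0 = y0" by (simp_all add: s_def t_def w_def)
    with x0 y0 show ?case by (simp add: s_Suc t_Suc)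
  next
    case (Suc n)
    then show ?case
      using F_mono G_mono by (metis s_Suc t_Suc)
  qed
  have inc: "incseq s" and dec: "decseq t"
    using mono by (auto intro: incseq_SucI decseq_SucI)
  have "convergent s"
  proof (rule convergent_if_dist_Suc_contracts[OF a])
    show "a + (b + c) < 1" using abc by simp
    \<comment> \<open>Since \<open>x \<ge> u\<close> abbreviates \<open>u \<le> x\<close>,
      \<open>of\<close> fills \<open>u\<close> first: the newer iterate \<open>s (Suc n)\<close>
      stands for \<open>x\<close>, so its step gets the coefficient \<open>a\<close>.\<close>
    show "dist (s (Suc n)) (s (Suc (Suc n)))
      \<le> a * dist (s (Suc n)) (s (Suc (Suc n))) + (b + c) * dist (s n) (s (Suc n))" for n
      using contrF[of "s n" "s (Suc n)" "t (Suc n)" "t n"] mono[of n]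
      by (simp add: s_Suc[symmetric] dist_commute distrib_right add.assoc)
  qed
  then obtain x where x: "s \<longlonglongrightarrow> x" by (auto simp: convergent_def)
  have "convergent t"
  \<comment> \<open>In \<open>Y\<close> the older iterate is the larger one and comes first in
    \<open>contrG\<close>, so \<open>a\<close> and \<open>b\<close> trade places.\<close>
  proof (rule convergent_if_dist_Suc_contracts[OF b])
    show "b + (a + c) < 1" using abc by simp
    show "dist (t (Suc n)) (t (Suc (Suc n)))
      \<le> b * dist (t (Suc n)) (t (Suc (Suc n))) + (a + c) * dist (t n) (t (Suc n))" for n
      using contrG[of "s n" "s (Suc n)" "t (Suc n)" "t n"] mono[of n]
      by (simp add: t_Suc[symmetric] distrib_right)
  qed
  then obtain y where y: "t \<longlonglongrightarrow> y" by (auto simp: convergent_def)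
  have s_le: "s n \<le> x" and t_ge: "y \<le> t n" for n
    using limX[OF inc x] limY[OF dec y] by auto
  have "x = F (x, y)"
  proof (rule limit_eq_if_dist_contracts[OF x a])
    show "dist (F (x, y)) (s (Suc n))
      \<le> a * dist x (F (x, y)) + b * dist (s n) (s (Suc n)) + c * dist x (s n)" for n
      using contrF[OF s_le t_ge, of n n] by (simp add: s_Suc)
  qed
  moreover have "y = G (y, x)"
  \<comment> \<open>The limit \<open>y\<close> lies below every \<open>t n\<close>, so it takes the
    second slot of \<open>contrG\<close> and its displacement carries \<open>b\<close>.\<close>
  proof (rule limit_eq_if_dist_contracts[OF y b])
    show "dist (G (y, x)) (t (Suc n))
      \<le> b * dist y (G (y, x)) + a * dist (t n) (t (Suc n)) + c * dist y (t n)" for n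
      using contrG[OF s_le t_ge, of n n] by (simp add: t_Suc dist_commute add_ac)
  qed
  ultimately show ?thesis by blast
qed

end
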